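(* Let $A\in\mathbb{C}^{m\times m}$ and $P\in\mathcal{H}_m$. Then there exists a vector $s^{(0)}\in\mathbb{R}^m$ such that $$|A-P|e\preceq \mathfrak{M}(P)s^{(0)}.\qquad( * )$$ Furthermore, if $s^{(0)}\in\mathbb{R}^m$ is any vector satisfying $( * )$, and the sequence $(s^{(k)})_{k\ge 0}$ is defined from $s^{(0)}$ by the iteration $$|\operatorname{diag}(P)|\,s^{(k+1)}=|\operatorname{off}(P)|\,s^{(k)}+|A-P|e,\qquad k\ge 0,$$ then $\mu(A,P)\le\|s^{(k)}\|_\infty$ for all $k\ge 0$, and $\lim_{k\to\infty}\|s^{(k)}\|_\infty=\mu(A,P)$.
   Context: For a complex matrix or vector $X$, $|X|$ denotes the matrix or vector of entrywise absolute values; $\operatorname{diag}(X)$ and $\operatorname{off}(X)=X-\operatorname{diag}(X)$ denote the diagonal part and the off-diagonal part of a square matrix $X$. For real matrices or vectors of the same size, $X\succeq Y$ (equivalently $Y\preceq X$) means that all entries of $X-Y$ are non-negative. $\|\cdot\|_\infty$ is the maximum norm on vectors, $I_m$ is the $m\times m$ identity matrix, $\varrho(\cdot)$ is the spectral radius, and $e=(1,\ldots,1)^\top\in\mathbb{R}^m$. Comparison matrix: for $A=[a_{ij}]\in\mathbb{C}^{m\times m}$, $\mathfrak{M}(A):=|\operatorname{diag}(A)|-|\operatorname{off}(A)|\in\mathbb{R}^{m\times m}$, i.e. $\mathfrak{M}(A)_{ii}=|a_{ii}|$ and $\mathfrak{M}(A)_{ij}=-|a_{ij}|$ for $i\neq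 j$. H-matrices: $\mathcal{H}_m$ is the set of all $A\in\mathbb{C}^{m\times m}$ for which $\mathfrak{M}(A)$ is a non-singular M-matrix, i.e. $\mathfrak{M}(A)=rI_m-B$ for some real matrix $B\succeq 0$ and some real $r>\varrho(B)$. (For $P\in\mathcal{H}_m$ both $P$ and $\mathfrak{M}(P)$ are invertible, $\mathfrak{M}(P)^{-1}\succeq 0$, and all diagonal entries of $P$ are non-zero, so the iteration is well defined.) Sassenfeld index: for $A\in\mathbb{C}^{m\times m}$ and $P\in\mathcal{H}_m$, put $s(A,P):=\mathfrak{M}(P)^{-1}|A-P|e\in\mathbb{R}^m$ and $\mu(A,P):=\|s(A,P)\|_\infty$. *)

theory Defs
  imports
    "Jordan_Normal_Form.Spectral_Radius"
    "Jordan_Normal_Form.Gauss_Jordan_Elimination"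
begin

text \<open>The entrywise order on real matrices and vectors is the library order \<open>\<le>\<close>, which also
  requires equal dimensions.\<close>

definition abs_mat :: "complex mat \<Rightarrow> real mat" where
  "abs_mat A = map_mat cmod A"

definition diag_part :: "'a :: zero mat \<Rightarrow> 'a mat" where
  "diag_part A = mat (dim_row A) (dim_col A) (\<lambda>(i, j). if i = j then A $$ (i, j) else 0)"

definition off_part :: "'a :: ab_group_add mat \<Rightarrow> 'a mat" where
  "off_part A = A - diag_part A"

definition ones_vec :: "nat \<Rightarrow> real vec" where
  "ones_vec m = vec m (\<lambda>_. 1)"

text \<open>Meaningful only for vectors of positive dimension.\<close>
definition max_norm :: "real vec \<Rightarrow> real" where
  "max_norm v = Max ((\<lambda>i. \<bar>v $ i\<bar>) ` {0..<dim_vec v})"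

definition comparison_mat :: "complex mat \<Rightarrow> real mat" where
  "comparison_mat A = abs_mat (diag_part A) - abs_mat (off_part A)"

definition nonsingular_M_matrix :: "nat \<Rightarrow> real mat \<Rightarrow> bool" where
  "nonsingular_M_matrix m M \<longleftrightarrow>
     (\<exists>B \<in> carrier_mat m m. \<exists>r :: real.
        0\<^sub>m m m \<le> B \<and> spectral_radius (map_mat complex_of_real B) < r \<and> M = r \<cdot>\<^sub>m 1\<^sub>m m - B)"

definition H_matrices :: "nat \<Rightarrow> complex mat set" where
  "H_matrices m = {A \<in> carrier_mat m m. nonsingular_M_matrix m (comparison_mat A)}"

text \<open>\<open>mat_inverse\<close> returns \<open>None\<close> on singular matrices; the definitions below are meant for
  \<open>P \<in> H_matrices m\<close>, where \<open>comparison_mat P\<close> is invertible.\<close>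
definition sassenfeld_vec :: "complex mat \<Rightarrow> complex mat \<Rightarrow> real vec" where
  "sassenfeld_vec A P =
     the (mat_inverse (comparison_mat P)) *\<^sub>v (abs_mat (A - P) *\<^sub>v ones_vec (dim_col A))"

definition sassenfeld_index :: "complex mat \<Rightarrow> complex mat \<Rightarrow> real" where
  "sassenfeld_index A P = max_norm (sassenfeld_vec A P)"

end

theory Submission
  imports Defs
begin

text \<open>Split the comparison matrix \<open>M\<close> of \<open>P\<close> as \<open>D - N\<close> into diagonal and off-diagonal part and put
  \<open>b = |A - P| e\<close>. The Sassenfeld vector \<open>x\<close> is the fixed point \<open>D x = N x + b\<close> of the iteration.
  Since \<open>0 \<le> M y\<close> implies \<open>0 \<le> y\<close>, the condition \<open>b \<le> M s\<^sub>0\<close> gives \<open>x \<le> s\<^sub>0\<close>; it also says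
  \<open>D s\<^sub>1 \<le> D s\<^sub>0\<close>. Both relations propagate because \<open>N\<close> is nonnegative and \<open>D\<close> has a positive
  diagonal, so the iterates decrease and stay above \<open>x \<ge> 0\<close>. Their limit solves the fixed point
  equation, hence equals \<open>x\<close>.\<close>

section \<open>Nonnegative matrices, powers and scalar multiples\<close>

lemma mult_mat_vec_mono:
  fixes A :: "real mat"
  assumes A: "A \<in> carrier_mat n m" and nonneg: "0\<^sub>m n m \<le> A"
    and v: "v \<in> carrier_vec m" and w: "w \<in> carrier_vec m" and le: "v \<le> w"
  shows "A *\<^sub>v v \<le> A *\<^sub>v w"
  using assms unfolding less_eq_vec_def less_eq_mat_def
  by (auto simp: scalar_prod_def intro!: sum_mono mult_left_mono)

lemma mult_mat_nonneg:
  fixes A B :: "real mat"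
  assumes "A \<in> carrier_mat n k" "B \<in> carrier_mat k m" "0\<^sub>m n k \<le> A" "0\<^sub>m k m \<le> B"
  shows "0\<^sub>m n m \<le> A * B"
  using assms unfolding less_eq_mat_def
  by (auto simp: scalar_prod_def intro!: sum_nonneg mult_nonneg_nonneg)

lemma pow_mat_nonneg:
  fixes A :: "real mat"
  assumes A: "A \<in> carrier_mat n n" and "0\<^sub>m n n \<le> A"
  shows "0\<^sub>m n n \<le> A ^\<^sub>m k"
proof (induction k)
  case 0
  then show ?case using A by (auto simp: less_eq_mat_def)
next
  case (Suc k)
  then show ?case using mult_mat_nonneg[of "A ^\<^sub>m k" n n A n] assms by simp
qed

lemma smult_mat_pow:
  fixes A :: "'a :: comm_ring_1 mat"
  assumes A: "A \<in> carrier_mat n n"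
  shows "(c \<cdot>\<^sub>m A) ^\<^sub>m k = c ^ k \<cdot>\<^sub>m (A ^\<^sub>m k)"
proof (induction k)
  case 0
  then show ?case by auto
next
  case (Suc k)
  have "c ^ k \<cdot>\<^sub>m (A ^\<^sub>m k) * (c \<cdot>\<^sub>m A) = c ^ Suc k \<cdot>\<^sub>m (A ^\<^sub>m k * A)"
    using A pow_carrier_mat[OF A, of k]
    by (auto intro!: eq_matI simp: scalar_prod_def sum_distrib_left ac_simps)
  with Suc show ?case by simp
qed

lemma smult_mat_mult_vec:
  fixes A :: "'a :: comm_ring_1 mat"
  assumes "A \<in> carrier_mat n m" "v \<in> carrier_vec m"
  shows "(c \<cdot>\<^sub>m A) *\<^sub>v v = c \<cdot>\<^sub>v (A *\<^sub>v v)"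
  using assms by (auto intro!: eq_vecI simp: scalar_prod_def sum_distrib_left ac_simps)

section \<open>Spectral radius and growth of matrix powers\<close>

lemma eigenvalue_norm_le_spectral_radius:
  assumes "A \<in> carrier_mat n n" "0 < n" "eigenvalue A k"
  shows "cmod k \<le> spectral_radius A"
  using assms spectral_radius_mem_max(2)[of A n "cmod k"] by (auto simp: spectrum_def)

lemma spectral_radius_nonneg:
  assumes "A \<in> carrier_mat n n" "0 < n"
  shows "0 \<le> spectral_radius A"
  using spectral_radius_mem_max(1)[OF assms] by auto

text \<open>An eigenvalue \<open>k\<close> of the scaled matrix yields the eigenvalue
  \<open>q * k\<close> of \<open>A\<close>, whose modulus is at most the spectral radius of
  \<open>A\<close> and hence below \<open>q\<close>.\<close>

lemma spectral_radius_smult_less_1: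
  assumes A: "A \<in> carrier_mat n n" and n: "0 < n" and q: "spectral_radius A < q"
  shows "spectral_radius (complex_of_real (1 / q) \<cdot>\<^sub>m A) < 1"
proof -
  let ?C = "complex_of_real (1 / q) \<cdot>\<^sub>m A"
  have C: "?C \<in> carrier_mat n n" using A by simp
  have q0: "0 < q" using spectral_radius_nonneg[OF A n] q by simp
  obtain k where k: "eigenvalue ?C k" "spectral_radius ?C = cmod k"
    using spectral_radius_mem_max(1)[OF C n] by (auto simp: spectrum_def)
  from k(1) obtain v where v: "v \<in> carrier_vec n" "v \<noteq> 0\<^sub>v n" "?C *\<^sub>v v = k \<cdot>\<^sub>v v"
    using A by (auto simp: eigenvalue_def eigenvector_def)
  have "A *\<^sub>v v = (of_real q * k) \<cdot>\<^sub>v v"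
  proof (rule eq_vecI)
    fix i assume "i < dim_vec ((of_real q * k) \<cdot>\<^sub>v v)"
    with v(1) have i: "i < n" by simp
    from v(3) have "(?C *\<^sub>v v) $ i = (k \<cdot>\<^sub>v v) $ i" by simp
    hence "complex_of_real (1 / q) * (A *\<^sub>v v) $ i = k * v $ i"
      using A v(1) i by (simp add: scalar_prod_def sum_distrib_left ac_simps sum_divide_distrib)
    thus "(A *\<^sub>v v) $ i = ((of_real q * k) \<cdot>\<^sub>v v) $ i"
      using q0 v(1) i by (simp add: field_simps)
  qed (use A v in auto)
  hence "eigenvalue A (of_real q * k)"
    using A v by (auto simp: eigenvalue_def eigenvector_def)
  from eigenvalue_norm_le_spectral_radius[OF A n this] q q0
  have "q * cmod k < q * 1" by (simp only: norm_mult norm_of_real abs_of_pos mult_1_right)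
  hence "cmod k < 1" unfolding mult_less_cancel_left_pos[OF q0] .
  with k(2) show ?thesis by simp
qed

text \<open>A matrix of spectral radius below 1 has uniformly bounded powers. This applies to
  \<open>A\<close> divided by \<open>q\<close>, and undoing the scaling in the \<open>k\<close>-th
  power restores the factor \<open>q ^ k\<close>.\<close>

lemma pow_mat_entry_bound:
  assumes A: "A \<in> carrier_mat n n" and n: "0 < n" and q: "spectral_radius A < q"
  obtains c where "\<And>k i j. i < n \<Longrightarrow> j < n \<Longrightarrow> cmod ((A ^\<^sub>m k) $$ (i, j)) \<le> c * q ^ k"
proof -
  let ?C = "complex_of_real (1 / q) \<cdot>\<^sub>m A"
  have q0: "0 < q" using spectral_radius_nonneg[OF A n] q by simp
  have "\<exists>c. \<forall>k. norm_bound (?C ^\<^sub>m k) c"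
    using A q n by (intro spectral_radius_jnf_norm_bound_less_1_upper_triangular[of _ n]
        spectral_radius_smult_less_1) auto
  then obtain c where c: "\<And>k. norm_bound (?C ^\<^sub>m k) c" by blast
  have "cmod ((A ^\<^sub>m k) $$ (i, j)) \<le> c * q ^ k" if "i < n" "j < n" for k i j
  proof -
    have "cmod ((?C ^\<^sub>m k) $$ (i, j)) \<le> c"
      using c[of k] that A by (simp add: norm_bound_def)
    hence "cmod ((A ^\<^sub>m k) $$ (i, j)) / q ^ k \<le> c"
      using that A q0 pow_carrier_mat[OF A, of k]
      by (simp add: smult_mat_pow[OF A] norm_mult norm_divide norm_power power_divide)
    thus ?thesis using q0 by (simp add: field_simps)
  qed
  thus thesis by (rule that)
qed

section \<open>Nonsingular M-matrices: monotonicity and invertibility\<close>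

lemma nonsingular_M_matrix_carrier:
  "nonsingular_M_matrix m M \<Longrightarrow> M \<in> carrier_mat m m"
  by (auto simp: nonsingular_M_matrix_def)

text \<open>If \<open>M = r I - B\<close>, then \<open>0 \<le> M x\<close> reads \<open>B x \<le> r x\<close>; iterating, \<open>B\<^sup>k x \<le> r\<^sup>k x\<close>, and
  \<open>r\<^sup>-\<^sup>k B\<^sup>k\<close> tends to \<open>0\<close>.\<close>
lemma nonsingular_M_matrix_monotone:
  assumes M: "nonsingular_M_matrix m M" and x: "x \<in> carrier_vec m"
    and Mx: "0\<^sub>v m \<le> M *\<^sub>v x"
  shows "0\<^sub>v m \<le> x"
\<comment> \<open>Dimension 0 is split off because the spectrum is then empty, while the spectral
  radius is its largest modulus.\<close>
proof (cases "m = 0")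
  case True
  with x show ?thesis by (auto simp: less_eq_vec_def)
next
  case False
  then have m: "0 < m" by simp
  from M obtain B r where B: "B \<in> carrier_mat m m" "0\<^sub>m m m \<le> B"
    and r: "spectral_radius (map_mat complex_of_real B) < r" and MB: "M = r \<cdot>\<^sub>m 1\<^sub>m m - B"
    by (auto simp: nonsingular_M_matrix_def)
  let ?B = "map_mat complex_of_real B"
  have Bc: "?B \<in> carrier_mat m m" using B by simp
  \<comment> \<open>The intermediate \<open>q\<close> leaves room on both sides: powers of
    \<open>B\<close> are bounded by a multiple of \<open>q ^ k\<close>, and \<open>q / r < 1\<close>
    makes this negligible against \<open>r ^ k\<close>.\<close>
  obtain q where q: "spectral_radius ?B < q" "q < r" using r dense by blast
  have q0: "0 < q" using spectral_radius_nonneg[OF Bc m] q by simp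
  obtain c where c: "\<And>k i j. i < m \<Longrightarrow> j < m \<Longrightarrow> cmod ((?B ^\<^sub>m k) $$ (i, j)) \<le> c * q ^ k"
    using pow_mat_entry_bound[OF Bc m q(1)] by blast
  have bound: "\<bar>(B ^\<^sub>m k) $$ (i, j)\<bar> \<le> c * q ^ k" if "i < m" "j < m" for i j k
    using c[OF that, of k] that B(1)
    by (simp add: of_real_hom.mat_hom_pow[OF B(1), symmetric])
  have Bx: "B *\<^sub>v x \<le> r \<cdot>\<^sub>v x"
  proof -
    have "M *\<^sub>v x = r \<cdot>\<^sub>v x - B *\<^sub>v x"
      using B x unfolding MB
      by (simp add: minus_mult_distrib_mat_vec[of _ m m] smult_mat_mult_vec[of _ m m])
    thus ?thesis using Mx B x by (auto simp: less_eq_vec_def)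
  qed
  have pow: "B ^\<^sub>m k *\<^sub>v x \<le> r ^ k \<cdot>\<^sub>v x" for k
  proof (induction k)
    case 0
    then show ?case using B x by simp
  next
    case (Suc k)
    have Bk: "B ^\<^sub>m k \<in> carrier_mat m m" using B by simp
    have "B ^\<^sub>m Suc k *\<^sub>v x = B ^\<^sub>m k *\<^sub>v (B *\<^sub>v x)"
      using assoc_mult_mat_vec[OF Bk B(1) x] by simp
    also have "\<dots> \<le> B ^\<^sub>m k *\<^sub>v (r \<cdot>\<^sub>v x)"
      using B x by (intro mult_mat_vec_mono[OF Bk] pow_mat_nonneg Bx) auto
    also have "\<dots> = r \<cdot>\<^sub>v (B ^\<^sub>m k *\<^sub>v x)"
      using Bk x by (rule mult_mat_vec)
    also have "\<dots> \<le> r ^ Suc k \<cdot>\<^sub>v x"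
      using Suc q q0 x Bk by (auto simp: less_eq_vec_def mult.assoc intro!: mult_left_mono)
    finally show ?case .
  qed
  have "0 \<le> x $ i" if i: "i < m" for i
  proof -
    \<comment> \<open>With this \<open>b\<close>, every entry of
      \<open>B ^\<^sub>m k *\<^sub>v x\<close> has modulus at most \<open>b * q ^ k\<close>.\<close>
    define b where "b = c * (\<Sum>j<m. \<bar>x $ j\<bar>)"
    have "- b * (q / r) ^ k \<le> x $ i" for k
    proof -
      have "\<bar>(B ^\<^sub>m k *\<^sub>v x) $ i\<bar> = \<bar>\<Sum>j<m. (B ^\<^sub>m k) $$ (i, j) * x $ j\<bar>"
        using B(1) x i pow_carrier_mat[OF B(1), of k]
        by (simp add: scalar_prod_def lessThan_atLeast0)
      also have "\<dots> \<le> (\<Sum>j<m. c * q ^ k * \<bar>x $ j\<bar>)"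
        using bound i by (intro order.trans[OF sum_abs] sum_mono)
          (auto simp: abs_mult intro!: mult_right_mono)
      also have "\<dots> = b * q ^ k" by (simp add: b_def sum_distrib_left sum_distrib_right ac_simps)
      finally have "- (b * q ^ k) \<le> (B ^\<^sub>m k *\<^sub>v x) $ i" by simp
      also have "\<dots> \<le> r ^ k * x $ i" using pow[of k] x i by (simp add: less_eq_vec_def del: index_mult_mat_vec)
      finally show ?thesis using q q0 by (simp add: field_simps)
    qed
    moreover have "(\<lambda>k. - b * (q / r) ^ k) \<longlonglongrightarrow> - b * 0"
      using q q0 by (intro tendsto_intros LIMSEQ_power_zero) auto
    ultimately show ?thesis
      by (intro LIMSEQ_le_const2[of "\<lambda>k. - b * (q / r) ^ k" "- b * 0", simplified]) auto
  qed
  with x show ?thesis by (simp add: less_eq_vec_def)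
qed

text \<open>Both \<open>y - x\<close> and \<open>x - y\<close> are mapped to zero, so monotonicity
  makes both nonnegative and antisymmetry of the order finishes.\<close>

lemma nonsingular_M_matrix_inj:
  assumes M: "nonsingular_M_matrix m M" and x: "x \<in> carrier_vec m" and y: "y \<in> carrier_vec m"
    and eq: "M *\<^sub>v x = M *\<^sub>v y"
  shows "x = y"
proof -
  have le: "u \<le> v" if "u \<in> carrier_vec m" "v \<in> carrier_vec m" "M *\<^sub>v u = M *\<^sub>v v" for u v
  proof -
    have "M *\<^sub>v (v - u) = 0\<^sub>v m"
      using that nonsingular_M_matrix_carrier[OF M] by (simp add: mult_minus_distrib_mat_vec)
    with nonsingular_M_matrix_monotone[OF M, of "v - u"] that show ?thesis
      by (auto simp: less_eq_vec_def)
  qed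
  show ?thesis using le[OF x y eq] le[OF y x eq[symmetric]] by simp
qed

text \<open>Injectivity excludes a nonzero kernel vector, so the determinant is nonzero. The result
  gives meaning to \<open>the (mat_inverse ...)\<close> in \<open>sassenfeld_vec\<close>.\<close>

lemma nonsingular_M_matrix_inverse:
  assumes M: "nonsingular_M_matrix m M"
  obtains N where "mat_inverse M = Some N" "N \<in> carrier_mat m m" "M * N = 1\<^sub>m m"
proof -
  note Mc = nonsingular_M_matrix_carrier[OF M]
  have "det M \<noteq> 0"
  proof
    assume "det M = 0"
    then obtain v where v: "v \<in> carrier_vec m" "v \<noteq> 0\<^sub>v m" "M *\<^sub>v v = 0\<^sub>v m"
      using det_0_iff_vec_prod_zero_field[OF Mc] by auto
    moreover have "M *\<^sub>v 0\<^sub>v m = 0\<^sub>v m" using Mc by auto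
    ultimately show False using nonsingular_M_matrix_inj[OF M, of v "0\<^sub>v m"] by simp
  qed
  hence "mat_inverse M \<noteq> None"
    using mat_inverse(1)[OF Mc, of "()"] det_non_zero_imp_unit[OF Mc, of "()"] by blast
  then obtain N where "mat_inverse M = Some N" by auto
  with mat_inverse(2)[OF Mc this] that show thesis by blast
qed

lemma nonsingular_M_matrix_le_mult_vecD:
  assumes M: "nonsingular_M_matrix m M" and x: "x \<in> carrier_vec m" and y: "y \<in> carrier_vec m"
    and le: "M *\<^sub>v x \<le> M *\<^sub>v y"
  shows "x \<le> y"
proof -
  have "0\<^sub>v m \<le> M *\<^sub>v (y - x)"
    using le x y nonsingular_M_matrix_carrier[OF M]
    by (auto simp: mult_minus_distrib_mat_vec less_eq_vec_def)
  with nonsingular_M_matrix_monotone[OF M, of "y - x"] x y show ?thesis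
    by (auto simp: less_eq_vec_def)
qed

section \<open>Splittings into a diagonal and a nonnegative matrix\<close>

lemma mult_mat_vec_diagonal:
  fixes D :: "'a :: semiring_0 mat"
  assumes "D \<in> carrier_mat m m" "diagonal_mat D" "v \<in> carrier_vec m" "i < m"
  shows "(D *\<^sub>v v) $ i = D $$ (i, i) * v $ i"
proof -
  have "(D *\<^sub>v v) $ i = (\<Sum>j = 0..<m. D $$ (i, j) * v $ j)"
    using assms by (simp add: scalar_prod_def)
  also have "\<dots> = (\<Sum>j = 0..<m. if j = i then D $$ (i, i) * v $ i else 0)"
    using assms by (intro sum.cong) (auto simp: diagonal_mat_def)
  finally show ?thesis using assms by simp
qed

text \<open>If the \<open>i\<close>-th diagonal entry were not positive, the negated unit vector \<open>- e\<^sub>i\<close> would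
  contradict monotonicity.\<close>
lemma nonsingular_M_matrix_splitting_diag_pos:
  assumes M: "nonsingular_M_matrix m (D - N)"
    and D: "D \<in> carrier_mat m m" "diagonal_mat D" and N: "N \<in> carrier_mat m m" "0\<^sub>m m m \<le> N"
    and i: "i < m"
  shows "0 < D $$ (i, i)"
proof (rule ccontr)
  assume neg: "\<not> 0 < D $$ (i, i)"
  let ?u = "- unit_vec m i :: real vec"
  have u: "?u \<in> carrier_vec m" by simp
  have "0 \<le> ((D - N) *\<^sub>v ?u) $ j" if j: "j < m" for j
  proof -
    have "((D - N) *\<^sub>v ?u) $ j = - ((D - N) $$ (j, i))"
      using D(1) N(1) i j by (simp add: scalar_prod_uminus_right)
    also have "\<dots> = N $$ (j, i) - D $$ (j, i)"
      using D(1) N(1) i j by simp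
    finally have "((D - N) *\<^sub>v ?u) $ j = N $$ (j, i) - D $$ (j, i)" .
    moreover have "D $$ (j, i) \<le> 0"
    proof (cases "j = i")
      case True
      with neg show ?thesis by simp
    next
      case False
      with D i j have "D $$ (j, i) = 0" by (simp add: diagonal_mat_def)
      then show ?thesis by simp
    qed
    moreover have "0 \<le> N $$ (j, i)" using N i j by (simp add: less_eq_mat_def)
    ultimately show ?thesis by simp
  qed
  hence "0\<^sub>v m \<le> (D - N) *\<^sub>v ?u"
    using N(1) by (simp add: less_eq_vec_def del: index_mult_mat_vec)
  hence "0\<^sub>v m \<le> ?u" by (rule nonsingular_M_matrix_monotone[OF M u])
  hence "0\<^sub>v m $ i \<le> ?u $ i"
    using i unfolding less_eq_vec_def index_uminus_vec(2) index_unit_vec(3) by blast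
  with i show False by simp
qed

section \<open>The iteration attached to a splitting \<open>D - N\<close>\<close>

context
  fixes m :: nat and D N :: "real mat" and b x :: "real vec" and s :: "nat \<Rightarrow> real vec"
  assumes M: "nonsingular_M_matrix m (D - N)"
    and D: "D \<in> carrier_mat m m" "diagonal_mat D" and N: "N \<in> carrier_mat m m" "0\<^sub>m m m \<le> N"
    and b: "b \<in> carrier_vec m"
    and x: "x \<in> carrier_vec m" "(D - N) *\<^sub>v x = b"
    and s: "\<And>k. s k \<in> carrier_vec m" "b \<le> (D - N) *\<^sub>v s 0"
    and iter: "\<And>k. D *\<^sub>v s (Suc k) = N *\<^sub>v s k + b"
begin

lemma diagonal_mult_le_cancel:
  assumes "v \<in> carrier_vec m" "w \<in> carrier_vec m" "D *\<^sub>v v \<le> D *\<^sub>v w"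
  shows "v \<le> w"
proof -
  have "v $ i \<le> w $ i" if i: "i < m" for i
  proof -
    have "D $$ (i, i) * v $ i \<le> D $$ (i, i) * w $ i"
      using assms(3) D i mult_mat_vec_diagonal[OF D assms(1) i] mult_mat_vec_diagonal[OF D assms(2) i]
      by (auto simp: less_eq_vec_def simp del: index_mult_mat_vec)
    thus ?thesis using nonsingular_M_matrix_splitting_diag_pos[OF M D N i] by simp
  qed
  with assms show ?thesis by (auto simp: less_eq_vec_def)
qed

lemma splitting_mult_vec:
  "v \<in> carrier_vec m \<Longrightarrow> (D - N) *\<^sub>v v = D *\<^sub>v v - N *\<^sub>v v"
  using D N by (simp add: minus_mult_distrib_mat_vec)

lemma splitting_solution: "D *\<^sub>v x = N *\<^sub>v x + b"
  using splitting_mult_vec[OF x(1)] x D N by auto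

lemma iterate_ge_solution: "x \<le> s k"
proof (induction k)
  case 0
  show ?case using nonsingular_M_matrix_le_mult_vecD[OF M x(1) s(1)] x(2) s(2) by simp
next
  case (Suc k)
  have "N *\<^sub>v x \<le> N *\<^sub>v s k" by (rule mult_mat_vec_mono[OF N x(1) s(1) Suc])
  hence "D *\<^sub>v x \<le> D *\<^sub>v s (Suc k)"
    using N b by (simp add: iter splitting_solution less_eq_vec_def)
  thus ?case by (rule diagonal_mult_le_cancel[OF x(1) s(1)])
qed

lemma iterate_decreasing: "s (Suc k) \<le> s k"
proof (induction k)
  case 0
  \<comment> \<open>The starting condition \<open>b \<le> D s\<^sub>0 - N s\<^sub>0\<close>
    rearranges to \<open>N s\<^sub>0 + b \<le> D s\<^sub>0\<close>, whose left side is
    \<open>D s\<^sub>1\<close>.\<close>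
  have "D *\<^sub>v s (Suc 0) \<le> D *\<^sub>v s 0"
    using s(2) D N b unfolding iter splitting_mult_vec[OF s(1)]
    by (auto simp: less_eq_vec_def field_simps)
  thus ?case by (rule diagonal_mult_le_cancel[OF s(1) s(1)])
next
  case (Suc k)
  have "N *\<^sub>v s (Suc k) \<le> N *\<^sub>v s k" by (rule mult_mat_vec_mono[OF N s(1) s(1) Suc])
  hence "D *\<^sub>v s (Suc (Suc k)) \<le> D *\<^sub>v s (Suc k)"
    using N b unfolding iter by (simp add: less_eq_vec_def)
  thus ?case by (rule diagonal_mult_le_cancel[OF s(1) s(1)])
qed

lemma iterate_tendsto_solution:
  assumes "i < m"
  shows "(\<lambda>k. s k $ i) \<longlonglongrightarrow> x $ i"
proof -
  have dim: "dim_vec (s k) = m" for k using s(1)[of k] by simp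
  \<comment> \<open>\<open>lim\<close> is a total operator; its values are genuine limits only once
    each coordinate is shown to be decreasing and bounded below by that of \<open>x\<close>.\<close>
  define t where "t = vec m (\<lambda>i. lim (\<lambda>k. s k $ i))"
  have t: "t \<in> carrier_vec m" by (simp add: t_def)
  have lim: "(\<lambda>k. s k $ i) \<longlonglongrightarrow> t $ i" if i: "i < m" for i
  proof -
    have "decseq (\<lambda>k. s k $ i)"
      using iterate_decreasing i dim by (auto simp: decseq_Suc_iff less_eq_vec_def)
    moreover have "x $ i \<le> s k $ i" for k
      using iterate_ge_solution[of k] i dim by (simp add: less_eq_vec_def)
    ultimately have "convergent (\<lambda>k. s k $ i)"
      using decseq_convergent[of "\<lambda>k. s k $ i" "x $ i"] by (metis convergentI)
    thus ?thesis using i by (simp add: t_def convergent_LIMSEQ_iff)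
  qed
  have lim_mult: "(\<lambda>k. (C *\<^sub>v s k) $ i) \<longlonglongrightarrow> (C *\<^sub>v t) $ i"
    if "i < m" "C \<in> carrier_mat m m" for C i
  proof -
    have entry: "(C *\<^sub>v v) $ i = (\<Sum>j<m. C $$ (i, j) * v $ j)" if "dim_vec v = m" for v
      using that \<open>i < m\<close> \<open>C \<in> carrier_mat m m\<close> by (simp add: scalar_prod_def lessThan_atLeast0)
    have "(\<lambda>k. \<Sum>j<m. C $$ (i, j) * s k $ j) \<longlonglongrightarrow> (\<Sum>j<m. C $$ (i, j) * t $ j)"
      by (intro tendsto_sum tendsto_mult_left lim) simp
    with entry[OF dim] entry[of t] t show ?thesis by simp
  qed
  have "D *\<^sub>v t = N *\<^sub>v t + b"
  proof (rule eq_vecI)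
    fix i assume "i < dim_vec (N *\<^sub>v t + b)"
    with b have i: "i < m" by simp
    have "(\<lambda>k. (N *\<^sub>v s k) $ i + b $ i) \<longlonglongrightarrow> (N *\<^sub>v t) $ i + b $ i"
      by (intro tendsto_intros lim_mult i N)
    moreover have "(N *\<^sub>v s k) $ i + b $ i = (D *\<^sub>v s (Suc k)) $ i" for k
      using i b N unfolding iter by simp
    ultimately have "(\<lambda>k. (D *\<^sub>v s (Suc k)) $ i) \<longlonglongrightarrow> (N *\<^sub>v t) $ i + b $ i" by simp
    \<comment> \<open>The index shift from \<open>k\<close> to \<open>Suc k\<close> does not change
      the limit, so two limits of the same sequence are compared.\<close>
    with LIMSEQ_Suc[OF lim_mult[OF i D(1)]] have "(D *\<^sub>v t) $ i = (N *\<^sub>v t) $ i + b $ i"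
      by (rule LIMSEQ_unique)
    with i b N show "(D *\<^sub>v t) $ i = (N *\<^sub>v t + b) $ i" by simp
  qed (use D b in simp)
  hence "(D - N) *\<^sub>v t = b"
    unfolding splitting_mult_vec[OF t] using N t b by auto
  with nonsingular_M_matrix_inj[OF M t x(1)] x(2) have "t = x" by simp
  with lim assms show ?thesis by simp
qed

end

section \<open>Monotonicity and continuity of the maximum norm\<close>

lemma max_norm_le_iff:
  assumes "0 < dim_vec v"
  shows "max_norm v \<le> c \<longleftrightarrow> (\<forall>i < dim_vec v. \<bar>v $ i\<bar> \<le> c)"
  using assms by (auto simp: max_norm_def)

lemma abs_le_max_norm: "i < dim_vec v \<Longrightarrow> \<bar>v $ i\<bar> \<le> max_norm v"
  by (simp add: max_norm_def)

lemma max_norm_mono: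
  assumes "0 < m" "w \<in> carrier_vec m" "0\<^sub>v m \<le> v" "v \<le> w"
  shows "max_norm v \<le> max_norm w"
proof -
  have dim: "dim_vec v = m" "dim_vec w = m" using assms by (auto simp: less_eq_vec_def)
  have "\<bar>v $ i\<bar> \<le> max_norm w" if "i < m" for i
    using abs_le_max_norm[of i w] assms(3,4) that dim by (force simp: less_eq_vec_def)
  with dim assms(1) show ?thesis by (simp add: max_norm_le_iff)
qed

text \<open>A triangle inequality in which the coarser 1-norm bounds the difference; a finite sum of
  coordinate errors is convenient for passing to limits.\<close>

lemma max_norm_le_add:
  assumes "0 < m" "v \<in> carrier_vec m" "w \<in> carrier_vec m"
  shows "max_norm v \<le> max_norm w + (\<Sum>i<m. \<bar>v $ i - w $ i\<bar>)"
proof -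
  have "\<bar>v $ i\<bar> \<le> max_norm w + (\<Sum>i<m. \<bar>v $ i - w $ i\<bar>)" if "i < m" for i
    using abs_le_max_norm[of i w] that assms member_le_sum[of i "{..<m}" "\<lambda>i. \<bar>v $ i - w $ i\<bar>"]
    by auto
  with assms show ?thesis by (simp add: max_norm_le_iff)
qed

text \<open>\<open>max_norm_le_add\<close>, used in both directions, bounds the difference of the
  norms by the sum of the coordinate errors, which tends to 0.\<close>

lemma tendsto_max_norm:
  assumes m: "0 < m" and s: "\<And>k. s k \<in> carrier_vec m" and x: "x \<in> carrier_vec m"
    and lim: "\<And>i. i < m \<Longrightarrow> (\<lambda>k. s k $ i) \<longlonglongrightarrow> x $ i"
  shows "(\<lambda>k. max_norm (s k)) \<longlonglongrightarrow> max_norm x"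
proof (rule LIM_zero_cancel, rule tendsto_rabs_zero_cancel, rule tendsto_sandwich[OF _ _ tendsto_const])
  show "\<forall>\<^sub>F k in sequentially. \<bar>max_norm (s k) - max_norm x\<bar> \<le> (\<Sum>i<m. \<bar>s k $ i - x $ i\<bar>)"
  proof (intro always_eventually allI)
    fix k
    have "(\<Sum>i<m. \<bar>x $ i - s k $ i\<bar>) = (\<Sum>i<m. \<bar>s k $ i - x $ i\<bar>)"
      by (intro sum.cong refl abs_minus_commute)
    with max_norm_le_add[OF m s[of k] x] max_norm_le_add[OF m x s[of k]]
    show "\<bar>max_norm (s k) - max_norm x\<bar> \<le> (\<Sum>i<m. \<bar>s k $ i - x $ i\<bar>)" by linarith
  qed
  have "(\<lambda>k. \<Sum>i<m. \<bar>s k $ i - x $ i\<bar>) \<longlonglongrightarrow> (\<Sum>i<m. \<bar>x $ i - x $ i\<bar>)"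
    by (intro tendsto_intros lim) simp
  thus "(\<lambda>k. \<Sum>i<m. \<bar>s k $ i - x $ i\<bar>) \<longlonglongrightarrow> 0" by simp
qed auto

section \<open>Application to the Sassenfeld index\<close>

lemma abs_mat_nonneg: "A \<in> carrier_mat n m \<Longrightarrow> 0\<^sub>m n m \<le> abs_mat A"
  by (auto simp: abs_mat_def less_eq_mat_def)

theorem proposition3p4:
  fixes m :: nat and A P :: "complex mat"
  assumes "0 < m"
    and "A \<in> carrier_mat m m"
    and "P \<in> H_matrices m"
  shows "(\<exists>s0 \<in> carrier_vec m. abs_mat (A - P) *\<^sub>v ones_vec m \<le> comparison_mat P *\<^sub>v s0) \<and>
    (\<forall>s0 \<in> carrier_vec m. abs_mat (A - P) *\<^sub>v ones_vec m \<le> comparison_mat P *\<^sub>v s0 \<longrightarrow>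
      (\<forall>s :: nat \<Rightarrow> real vec.
        s 0 = s0 \<and>
        (\<forall>k. s k \<in> carrier_vec m) \<and>
        (\<forall>k. abs_mat (diag_part P) *\<^sub>v s (Suc k) =
              abs_mat (off_part P) *\<^sub>v s k + abs_mat (A - P) *\<^sub>v ones_vec m) \<longrightarrow>
        (\<forall>k. sassenfeld_index A P \<le> max_norm (s k)) \<and>
        (\<lambda>k. max_norm (s k)) \<longlonglongrightarrow> sassenfeld_index A P))"
proof -
  let ?D = "abs_mat (diag_part P)" and ?N = "abs_mat (off_part P)"
  let ?b = "abs_mat (A - P) *\<^sub>v ones_vec m"
  define x where "x = sassenfeld_vec A P"
  from assms(3) have P: "P \<in> carrier_mat m m" and M: "nonsingular_M_matrix m (?D - ?N)"
    by (auto simp: H_matrices_def comparison_mat_def)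
  have D: "?D \<in> carrier_mat m m" "diagonal_mat ?D"
    using P by (auto simp: abs_mat_def diag_part_def diagonal_mat_def)
  have off: "off_part P \<in> carrier_mat m m"
    using P by (auto simp: off_part_def diag_part_def)
  have N: "?N \<in> carrier_mat m m" "0\<^sub>m m m \<le> ?N"
    using off abs_mat_nonneg[OF off] by (simp_all add: abs_mat_def)
  have b: "?b \<in> carrier_vec m" using P by (intro carrier_vecI) (simp add: abs_mat_def)
  have b_nonneg: "0\<^sub>v m \<le> ?b"
    using P by (auto simp: less_eq_vec_def abs_mat_def scalar_prod_def ones_vec_def intro!: sum_nonneg)
  obtain L where L: "mat_inverse (?D - ?N) = Some L" "L \<in> carrier_mat m m" "(?D - ?N) * L = 1\<^sub>m m"
    using nonsingular_M_matrix_inverse[OF M] by blast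
  have x_eq: "x = L *\<^sub>v ?b"
    using L(1) assms(2) by (simp add: x_def sassenfeld_vec_def comparison_mat_def)
  have x: "x \<in> carrier_vec m" using x_eq L(2) b by simp
  have Mx: "(?D - ?N) *\<^sub>v x = ?b"
    unfolding x_eq
    using assoc_mult_mat_vec[OF nonsingular_M_matrix_carrier[OF M] L(2) b] L(3) b by simp
  \<comment> \<open>Since \<open>max_norm\<close> takes absolute values, the nonnegativity of
    \<open>x\<close> is what turns \<open>x \<le> s k\<close> into an inequality of norms.\<close>
  have x_nonneg: "0\<^sub>v m \<le> x"
    using nonsingular_M_matrix_monotone[OF M x] Mx b_nonneg by simp
  show ?thesis
  proof (intro conjI ballI impI allI; (elim conjE)?)
    \<comment> \<open>The Sassenfeld vector itself is an admissible start, with equality.\<close>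
    show "\<exists>s0 \<in> carrier_vec m. ?b \<le> comparison_mat P *\<^sub>v s0"
      unfolding comparison_mat_def by (rule bexI[OF _ x]) (simp only: Mx order.refl)
  next
    fix s0 and s :: "nat \<Rightarrow> real vec"
    assume ge: "?b \<le> comparison_mat P *\<^sub>v s0" and s0: "s 0 = s0" and s: "\<forall>k. s k \<in> carrier_vec m"
      and iter: "\<forall>k. ?D *\<^sub>v s (Suc k) = ?N *\<^sub>v s k + ?b"
    have start: "?b \<le> (?D - ?N) *\<^sub>v s 0" using ge s0 by (simp add: comparison_mat_def)
    \<comment> \<open>These facts discharge the assumptions of the splitting context, in their order
      there.\<close>
    note jacobi = M D N b x Mx s[rule_format] start iter[rule_format]
    show "sassenfeld_index A P \<le> max_norm (s k)" for k
      using max_norm_mono[OF assms(1) s[rule_format] x_nonneg iterate_ge_solution[OF jacobi]]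
      by (simp add: sassenfeld_index_def x_def)
    show "(\<lambda>k. max_norm (s k)) \<longlonglongrightarrow> sassenfeld_index A P"
      using tendsto_max_norm[OF assms(1) s[rule_format] x iterate_tendsto_solution[OF jacobi]]
      by (simp add: sassenfeld_index_def x_def)
  qed
qed

end
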